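(* Let $C$ be a nonempty convex compact subset of $\mathbb{R}$. Suppose that $\Psi = \{T_i : i \in I\}$ is a family of (pairwise) commutative nonexpansive set-valued mappings from $C$ into $2^{C}$ in which there are at most two mappings that are not single-valued. If for each $i \in I$ and each $x \in C$ the set $T_i(x)$ is a nonempty closed convex subset of $C$, then the set of common fixed points of $\Psi$, namely $\{x \in C : x \in T_i(x) \text{ for all } i \in I\}$, is a nonempty convex nonexpansive retract of $C$.
   Context: $2^{C}$ denotes the set of all subsets of $C$, and $\mathbb{R}$ carries its usual metric $d(x,y)=|x-y|$. A mapping $T: C \to 2^C$ is single-valued if $T(x)$ is a singleton for every $x \in C$. Composition and commutativity: $T \circ S(x) = \bigcup_{y \in S(x)} T(y)$. $T$ and $S$ are commutative if $T \circ S(x) = S \circ T(x)$ for all $x \in C$. Hausdorff metric: for nonempty closed bounded sets $A, B$, $H(A,B) = \max\{\sup_{a \in A} d(a,B), \sup_{b \in B} d(b,A)\}$, where $d(a,B)=\inf_{b\in B} d(a,b)$. Nonexpansive: a set-valued mapping $T$ with nonempty closed bounded values is nonexpansive if $H(T(x), T(y)) \le d(x,y)$ for all $x, y \in C$. A point-valued mapping $R$ is nonexpansive if $d(R(x),R(y)) \le d(x,y)$ for all $x,y$. Nonexpansive retract: a nonempty subset $D \subseteq C$ is a nonexpansive retract of $C$ if there is a nonexpansive mapping $R : C \to D$ with $R(x) = x$ for all $x \in D$. *)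

theory Defs
  imports "HOL-Analysis.Analysis"
begin

text \<open>
  A set-valued mapping from \<open>C\<close> into \<open>Pow C\<close> is a function \<open>T :: 'a \<Rightarrow> 'a set\<close> with
  \<open>T \<in> C \<rightarrow> Pow C\<close>; its values outside \<open>C\<close> carry no meaning.
\<close>

definition single_valued_on :: "'a set \<Rightarrow> ('a \<Rightarrow> 'b set) \<Rightarrow> bool" where
  "single_valued_on C T \<longleftrightarrow> (\<forall>x\<in>C. is_singleton (T x))"

definition set_comp :: "('b \<Rightarrow> 'c set) \<Rightarrow> ('a \<Rightarrow> 'b set) \<Rightarrow> 'a \<Rightarrow> 'c set" where
  "set_comp T S x = (\<Union>y\<in>S x. T y)"

definition commute_on :: "'a set \<Rightarrow> ('a \<Rightarrow> 'a set) \<Rightarrow> ('a \<Rightarrow> 'a set) \<Rightarrow> bool" where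
  "commute_on C T S \<longleftrightarrow> (\<forall>x\<in>C. set_comp T S x = set_comp S T x)"

text \<open>Meaningful for nonempty bounded sets only, where both suprema are taken over nonempty
  sets of reals that are bounded above.\<close>

definition hausdorff_dist :: "'a::metric_space set \<Rightarrow> 'a set \<Rightarrow> real" where
  "hausdorff_dist A B = max (SUP a\<in>A. infdist a B) (SUP b\<in>B. infdist b A)"

definition set_nonexpansive_on :: "'a set \<Rightarrow> ('a::metric_space \<Rightarrow> 'b::metric_space set) \<Rightarrow> bool" where
  "set_nonexpansive_on C T \<longleftrightarrow>
     (\<forall>x\<in>C. T x \<noteq> {} \<and> closed (T x) \<and> bounded (T x)) \<and>
     (\<forall>x\<in>C. \<forall>y\<in>C. hausdorff_dist (T x) (T y) \<le> dist x y)"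

definition nonexpansive_on :: "'a set \<Rightarrow> ('a::metric_space \<Rightarrow> 'b::metric_space) \<Rightarrow> bool" where
  "nonexpansive_on C R \<longleftrightarrow> (\<forall>x\<in>C. \<forall>y\<in>C. dist (R x) (R y) \<le> dist x y)"

definition nonexpansive_retract :: "'a::metric_space set \<Rightarrow> 'a set \<Rightarrow> bool" where
  "nonexpansive_retract D C \<longleftrightarrow>
     D \<noteq> {} \<and> D \<subseteq> C \<and> (\<exists>R \<in> C \<rightarrow> D. nonexpansive_on C R \<and> (\<forall>x\<in>D. R x = x))"

text \<open>
  The set of members of the family \<open>{T i | i \<in> I}\<close> that are not single-valued. Members are compared
  as mappings with domain \<open>C\<close>, hence the restriction: repetitions of a mapping under different
  indices are counted once, and differing values outside \<open>C\<close> are ignored.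
\<close>

definition multivalued_members ::
    "'a set \<Rightarrow> 'i set \<Rightarrow> ('i \<Rightarrow> 'a \<Rightarrow> 'b set) \<Rightarrow> ('a \<Rightarrow> 'b set) set" where
  "multivalued_members C I T = {restrict (T i) C | i. i \<in> I \<and> \<not> single_valued_on C (T i)}"

definition common_fixed_points :: "'a set \<Rightarrow> 'i set \<Rightarrow> ('i \<Rightarrow> 'a \<Rightarrow> 'a set) \<Rightarrow> 'a set" where
  "common_fixed_points C I T = {x \<in> C. \<forall>i\<in>I. x \<in> T i x}"

end

theory Submission
  imports Defs
begin

text \<open>
  Every fixed point set \<open>Fix T = {x \<in> C. x \<in> T x}\<close> is a nonempty compact interval: \<open>x \<mapsto> min (T x)\<close>
  is a nonexpansive selection, and nonexpansiveness propagates \<open>T x < x\<close> to the right and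
  \<open>T x > x\<close> to the left. On the line it therefore suffices (Helly) that the fixed point sets of two
  commuting mappings \<open>T\<close>, \<open>S\<close> meet. If \<open>Fix T\<close> lay strictly below \<open>Fix S\<close>, then for \<open>q = max (Fix T)\<close>
  the set \<open>S q\<close> would lie strictly above \<open>q\<close> while \<open>S q \<subseteq> S (T q) = T (S q)\<close>; but \<open>T y < y\<close> for all
  \<open>y > q\<close>, so \<open>max (S q)\<close> cannot belong to \<open>T (S q)\<close>. The retraction is the nearest-point projection.
\<close>

text \<open>Boundedness of \<open>A\<close> bounds the distances to \<open>B\<close> from above, so
  the real-valued supremum is a genuine upper bound.\<close>

lemma infdist_le_hausdorff_dist:
  assumes "bounded A" and "bounded B" and "B \<noteq> {}" and "a \<in> A"
  shows "infdist a B \<le> hausdorff_dist A B"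
proof -
  obtain b where b: "b \<in> B" using assms by blast
  obtain e where "\<And>x. x \<in> A \<Longrightarrow> dist b x \<le> e"
    using assms(1) bounded_any_center[of A b] by blast
  then have "infdist x B \<le> e" if "x \<in> A" for x
    using that infdist_le[OF b, of x] by (metis dist_commute order_trans)
  then have "bdd_above ((\<lambda>x. infdist x B) ` A)"
    by (meson bdd_aboveI2)
  then have "infdist a B \<le> (SUP x\<in>A. infdist x B)"
    using assms(4) by (rule cSUP_upper2[OF _ _ order_refl])
  then show ?thesis
    unfolding hausdorff_dist_def by simp
qed

text \<open>The working form of nonexpansiveness: the distance from \<open>t\<close> to the closed
  set \<open>T x\<close> is attained, so \<open>t\<close> has a partner in
  \<open>T x\<close>.\<close>

lemma set_nonexpansive_on_close:
  fixes T :: "'a::metric_space \<Rightarrow> 'b::heine_borel set"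
  assumes "set_nonexpansive_on C T" and "x \<in> C" and "y \<in> C" and "t \<in> T y"
  obtains s where "s \<in> T x" and "dist t s \<le> dist x y"
proof -
  have T: "T x \<noteq> {}" "closed (T x)" "bounded (T x)" "bounded (T y)"
      "hausdorff_dist (T y) (T x) \<le> dist y x"
    using assms unfolding set_nonexpansive_on_def by auto
  obtain s where "s \<in> T x" "infdist t (T x) = dist t s"
    using infdist_attains_inf[OF T(2) T(1)] by metis
  then show thesis
    using that[of s] infdist_le_hausdorff_dist[OF T(4) T(3) T(1) assms(4)] T(5)
    by (simp add: dist_commute)
qed

text \<open>A fixed point \<open>y\<close> near a limit point \<open>x\<close> has a partner in
  \<open>T x\<close> within \<open>dist x y\<close>, hence within \<open>2 * dist x y\<close> of
  \<open>x\<close>. So \<open>x\<close> lies in the closure of \<open>T x\<close>.\<close>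

lemma closed_fixed_points:
  fixes T :: "'a::heine_borel \<Rightarrow> 'a set"
  assumes "closed C" and "set_nonexpansive_on C T"
  shows "closed {x \<in> C. x \<in> T x}" (is "closed ?F")
proof -
  have "x \<in> ?F" if x: "x \<in> closure ?F" for x
  proof -
    have xC: "x \<in> C"
      using x closure_minimal[of ?F C] assms(1) by blast
    have "x \<in> closure (T x)"
      unfolding closure_approachable
    proof (intro allI impI)
      fix e :: real
      assume "e > 0"
      then obtain y where y: "y \<in> C" "y \<in> T y" "dist y x < e / 2"
        using x unfolding closure_approachable by (metis (no_types, lifting) half_gt_zero mem_Collect_eq)
      obtain s where "s \<in> T x" "dist y s \<le> dist x y"
        using set_nonexpansive_on_close[OF assms(2) xC y(1,2)] .
      then have "dist s x < e"
        using y(3) dist_triangle2[of s x y] by (simp add: dist_commute)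
      then show "\<exists>s\<in>T x. dist s x < e"
        using \<open>s \<in> T x\<close> by blast
    qed
    moreover have "closed (T x)"
      using assms(2) xC unfolding set_nonexpansive_on_def by blast
    ultimately show ?thesis
      using xC by simp
  qed
  then show ?thesis
    using closure_subset_eq by blast
qed

text \<open>Helly in dimension one: every left endpoint is at most every right endpoint, so the
  supremum of the left endpoints lies in each interval. Since \<open>le\<close> covers both orders
  of \<open>i\<close> and \<open>j\<close>, it amounts to pairwise intersection.\<close>

lemma Inf_Helly_compact_intervals:
  fixes F :: "'i \<Rightarrow> real set"
  assumes "I \<noteq> {}"
    and F: "\<And>i. i \<in> I \<Longrightarrow> F i \<noteq> {} \<and> compact (F i) \<and> convex (F i)"
    and le: "\<And>i j. i \<in> I \<Longrightarrow> j \<in> I \<Longrightarrow> \<exists>x\<in>F i. \<exists>y\<in>F j. x \<le> y"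
  shows "(SUP i\<in>I. Inf (F i)) \<in> (\<Inter>i\<in>I. F i)"
proof
  fix j
  assume j: "j \<in> I"
  have bdd: "bdd_below (F i)" "bdd_above (F i)" if "i \<in> I" for i
    using F[OF that] by (simp_all add: compact_imp_bounded bounded_imp_bdd_below bounded_imp_bdd_above)
  have le': "Inf (F i) \<le> Sup (F k)" if ik: "i \<in> I" "k \<in> I" for i k
  proof -
    obtain x y where "x \<in> F i" "y \<in> F k" "x \<le> y"
      using le[OF ik] by blast
    then show ?thesis
      using cInf_lower[OF _ bdd(1)[OF ik(1)]] cSup_upper[OF _ bdd(2)[OF ik(2)]] by fastforce
  qed
  have "Inf (F j) \<le> (SUP i\<in>I. Inf (F i))"
    using j bdd_aboveI2[OF le'[OF _ j]] by (rule cSUP_upper)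
  moreover have "(SUP i\<in>I. Inf (F i)) \<le> Sup (F j)"
    using assms(1) le'[OF _ j] by (intro cSUP_least)
  moreover have "Inf (F j) \<in> F j" "Sup (F j) \<in> F j"
    using F[OF j] bdd[OF j]
    by (simp_all add: closed_contains_Inf closed_contains_Sup compact_imp_closed)
  ultimately show "(SUP i\<in>I. Inf (F i)) \<in> F j"
    using F[OF j] unfolding is_interval_convex_1[symmetric] is_interval_1 by blast
qed

lemma convex_real_not_mem:
  fixes A :: "real set"
  assumes "convex A" and "x \<notin> A"
  shows "(\<forall>t\<in>A. t < x) \<or> (\<forall>t\<in>A. x < t)"
  using assms unfolding is_interval_convex_1[symmetric] is_interval_1 by (meson linorder_le_less_linear)

text \<open>A point \<open>t\<close> of \<open>T y\<close> has a partner \<open>s < x\<close> in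
  \<open>T x\<close>, so \<open>t \<le> s + (y - x) < y\<close>.\<close>

lemma set_nonexpansive_on_below:
  fixes T :: "real \<Rightarrow> real set"
  assumes "set_nonexpansive_on C T" and "x \<in> C" and "y \<in> C" and "x \<le> y" and "\<forall>t\<in>T x. t < x"
  shows "\<forall>t\<in>T y. t < y"
proof
  fix t
  assume "t \<in> T y"
  then obtain s where "s \<in> T x" "dist t s \<le> dist x y"
    using set_nonexpansive_on_close[OF assms(1-3)] by blast
  then show "t < y"
    using assms(4,5) by (force simp: dist_real_def)
qed

lemma set_nonexpansive_on_above:
  fixes T :: "real \<Rightarrow> real set"
  assumes "set_nonexpansive_on C T" and "x \<in> C" and "y \<in> C" and "y \<le> x" and "\<forall>t\<in>T x. x < t"
  shows "\<forall>t\<in>T y. y < t"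
proof
  fix t
  assume "t \<in> T y"
  then obtain s where "s \<in> T x" "dist t s \<le> dist x y"
    using set_nonexpansive_on_close[OF assms(1-3)] by blast
  then show "y < t"
    using assms(4,5) by (force simp: dist_real_def)
qed

text \<open>For \<open>z\<close> between fixed points \<open>x \<le> z \<le> y\<close>, values
  strictly below \<open>z\<close> would propagate right to \<open>y\<close>, values strictly above
  would propagate left to \<open>x\<close>.\<close>

lemma convex_fixed_points:
  fixes T :: "real \<Rightarrow> real set"
  assumes "convex C" and T: "set_nonexpansive_on C T" and "\<And>x. x \<in> C \<Longrightarrow> convex (T x)"
  shows "convex {x \<in> C. x \<in> T x}"
  unfolding is_interval_convex_1[symmetric] is_interval_1
proof (intro ballI allI impI, elim conjE)
  fix x y z
  assume x: "x \<in> {x \<in> C. x \<in> T x}" and y: "y \<in> {x \<in> C. x \<in> T x}" and "x \<le> z" "z \<le> y"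
  then have z: "z \<in> C"
    using assms(1) unfolding is_interval_convex_1[symmetric] is_interval_1 by blast
  have "\<not> (\<forall>t\<in>T z. t < z)"
    using set_nonexpansive_on_below[OF T z _ \<open>z \<le> y\<close>] y by blast
  moreover have "\<not> (\<forall>t\<in>T z. z < t)"
    using set_nonexpansive_on_above[OF T z _ \<open>x \<le> z\<close>] x by blast
  ultimately show "z \<in> {x \<in> C. x \<in> T x}"
    using convex_real_not_mem[OF assms(3)[OF z]] z by blast
qed

lemma fixed_point_exists:
  fixes T :: "real \<Rightarrow> real set"
  assumes "C \<noteq> {}" and "convex C" and "compact C" and "T \<in> C \<rightarrow> Pow C"
    and T: "set_nonexpansive_on C T"
  shows "{x \<in> C. x \<in> T x} \<noteq> {}"
proof -
  have Tx: "T x \<noteq> {}" "closed (T x)" "bdd_below (T x)" if "x \<in> C" for x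
    using T that unfolding set_nonexpansive_on_def by (auto simp: bounded_imp_bdd_below)
  have Inf_mem: "Inf (T x) \<in> T x" if "x \<in> C" for x
    using closed_contains_Inf[OF Tx(1) Tx(3) Tx(2)] that by blast
  \<comment> \<open>The partner in \<open>T x\<close> of the point \<open>Inf (T y)\<close> bounds
    \<open>Inf (T x)\<close> from above; exchanging \<open>x\<close> and \<open>y\<close> gives the
    Lipschitz bound, and Brouwer applies to this selection.\<close>
  have Inf_le: "Inf (T x) \<le> Inf (T y) + dist x y" if xy: "x \<in> C" "y \<in> C" for x y
  proof -
    obtain s where "s \<in> T x" "dist (Inf (T y)) s \<le> dist x y"
      using set_nonexpansive_on_close[OF T xy Inf_mem[OF xy(2)]] .
    then show ?thesis
      using cInf_lower[OF _ Tx(3)[OF xy(1)], of s] by (simp add: dist_real_def)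
  qed
  have "dist (Inf (T x)) (Inf (T y)) \<le> dist x y" if "x \<in> C" "y \<in> C" for x y
    using Inf_le[OF that] Inf_le[OF that(2,1)] by (simp add: dist_real_def)
  then have "continuous_on C (\<lambda>x. Inf (T x))"
    unfolding continuous_on_iff by (meson order_le_less_trans)
  moreover have "(\<lambda>x. Inf (T x)) \<in> C \<rightarrow> C"
    using Inf_mem assms(4) by blast
  ultimately obtain x where "x \<in> C" "Inf (T x) = x"
    using brouwer[OF assms(3,2,1), of "\<lambda>x. Inf (T x)"] by metis
  then show ?thesis
    using Inf_mem by force
qed

text \<open>One half of the statement that the two fixed point intervals meet; exchanging
  \<open>S\<close> and \<open>T\<close> gives the other.\<close>

lemma commuting_fixed_points_le:
  fixes S T :: "real \<Rightarrow> real set"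
  assumes "C \<noteq> {}" and "convex C" and "compact C"
    and "S \<in> C \<rightarrow> Pow C" and "T \<in> C \<rightarrow> Pow C"
    and S: "set_nonexpansive_on C S" and T: "set_nonexpansive_on C T"
    and convS: "\<And>x. x \<in> C \<Longrightarrow> convex (S x)" and convT: "\<And>x. x \<in> C \<Longrightarrow> convex (T x)"
    and "commute_on C S T"
  shows "\<exists>x\<in>{x \<in> C. x \<in> S x}. \<exists>y\<in>{y \<in> C. y \<in> T y}. x \<le> y"
proof (rule ccontr)
  assume "\<not> ?thesis"
  then have less: "y < x" if "x \<in> C" "x \<in> S x" "y \<in> C" "y \<in> T y" for x y
    using that not_le by blast
  let ?F = "{x \<in> C. x \<in> T x}"
  have "?F \<noteq> {}" "compact ?F"
    using fixed_point_exists[OF assms(1-3,5) T] closed_fixed_points[OF _ T]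
      compact_Int_closed[OF assms(3), of ?F] compact_imp_closed[OF assms(3)]
    by (simp_all add: Int_def)
  then obtain q where q: "q \<in> C" "q \<in> T q" and q_max: "\<And>y. y \<in> C \<Longrightarrow> y \<in> T y \<Longrightarrow> y \<le> q"
    using compact_attains_sup[of ?F] by blast
  obtain r where r: "r \<in> C" "r \<in> S r"
    using fixed_point_exists[OF assms(1-4) S] by blast
  have "q \<notin> S q"
    using less[OF q(1) _ q] by blast
  \<comment> \<open>Otherwise this would propagate right from \<open>q\<close> to the fixed point
    \<open>r > q\<close> of \<open>S\<close>.\<close>
  moreover have "\<not> (\<forall>t\<in>S q. t < q)"
    using set_nonexpansive_on_below[OF S q(1) r(1)] less[OF r q] r(2) by fastforce
  ultimately have above: "\<forall>t\<in>S q. q < t"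
    using convex_real_not_mem[OF convS[OF q(1)]] by blast
  have "compact (S q)" "S q \<noteq> {}"
    using S q(1) unfolding set_nonexpansive_on_def by (auto simp: compact_eq_bounded_closed)
  then obtain m where m: "m \<in> S q" "\<And>y. y \<in> S q \<Longrightarrow> y \<le> m"
    using compact_attains_sup[of "S q"] by blast
  have "m \<in> set_comp S T q"
    using m(1) q(2) unfolding set_comp_def by blast
  also have "set_comp S T q = set_comp T S q"
    using assms(10) q(1) unfolding commute_on_def by blast
  finally obtain y where y: "y \<in> S q" "m \<in> T y"
    unfolding set_comp_def by blast
  have yC: "y \<in> C"
    using y(1) q(1) assms(4) by blast
  have "q < y"
    using above y(1) by blast
  then have "y \<notin> T y"
    using q_max[OF yC] by force
  \<comment> \<open>\<open>T y\<close> contains \<open>m \<ge> y\<close>, so it cannot lie below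
    \<open>y\<close>. Lying above \<open>y\<close>, it forces \<open>T q\<close> above
    \<open>q\<close>, against the choice of \<open>q\<close>.\<close>
  then have "\<forall>t\<in>T y. y < t"
    using convex_real_not_mem[OF convT[OF yC]] m(2)[OF y(1)] y(2) by force
  then have "\<forall>t\<in>T q. q < t"
    using set_nonexpansive_on_above[OF T yC q(1)] \<open>q < y\<close> by simp
  then show False
    using q(2) by blast
qed

text \<open>Nearest-point projection onto a nonempty closed convex set is 1-Lipschitz and fixes that
  set pointwise.\<close>

lemma nonexpansive_retract_closed_convex:
  fixes D :: "'a::euclidean_space set"
  assumes "D \<noteq> {}" and "D \<subseteq> C" and "closed D" and "convex D"
  shows "nonexpansive_retract D C"
  unfolding nonexpansive_retract_def nonexpansive_on_def
  using assms closest_point_lipschitz[of D] closest_point_in_set[of D] closest_point_self[of _ D]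
  by (intro conjI bexI[of _ "closest_point D"]) auto

theorem theorem2p4:
  fixes C :: "real set" and I :: "'i set" and T :: "'i \<Rightarrow> real \<Rightarrow> real set"
  assumes "C \<noteq> {}" and "convex C" and "compact C"
    and "\<And>i. i \<in> I \<Longrightarrow> T i \<in> C \<rightarrow> Pow C"
    and "\<And>i j. i \<in> I \<Longrightarrow> j \<in> I \<Longrightarrow> commute_on C (T i) (T j)"
    and "\<And>i. i \<in> I \<Longrightarrow> set_nonexpansive_on C (T i)"
    and "finite (multivalued_members C I T)" and "card (multivalued_members C I T) \<le> 2"
    and "\<And>i x. i \<in> I \<Longrightarrow> x \<in> C \<Longrightarrow> T i x \<noteq> {} \<and> closed (T i x) \<and> convex (T i x)"
  shows "common_fixed_points C I T \<noteq> {} \<and> convex (common_fixed_points C I T) \<and>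
    nonexpansive_retract (common_fixed_points C I T) C"
proof -
  let ?D = "common_fixed_points C I T"
  define F where "F i = {x \<in> C. x \<in> T i x}" for i
  \<comment> \<open>The factor \<open>C\<close> matters for \<open>I = {}\<close>, where the
    intersection over \<open>I\<close> is the whole line.\<close>
  have D: "?D = C \<inter> (\<Inter>i\<in>I. F i)"
    unfolding common_fixed_points_def F_def by auto
  have closedC: "closed C"
    using assms(3) by (rule compact_imp_closed)
  have closedF: "closed (F i)" and convF: "convex (F i)" if "i \<in> I" for i
    unfolding F_def using assms(9)[OF that]
    by (simp_all add: closed_fixed_points[OF closedC assms(6)[OF that]]
        convex_fixed_points[OF assms(2) assms(6)[OF that]])
  have "?D \<noteq> {}"
  proof (cases "I = {}")
    case True
    then show ?thesis
      using assms(1) D by simp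
  next
    case False
    have "(SUP i\<in>I. Inf (F i)) \<in> (\<Inter>i\<in>I. F i)"
    proof (rule Inf_Helly_compact_intervals[OF False])
      fix i
      assume i: "i \<in> I"
      have "compact (F i)"
        using compact_Int_closed[OF assms(3) closedF[OF i]] unfolding F_def by (simp add: Int_def)
      then show "F i \<noteq> {} \<and> compact (F i) \<and> convex (F i)"
        using convF[OF i] fixed_point_exists[OF assms(1-3) assms(4)[OF i] assms(6)[OF i]]
        unfolding F_def by blast
    next
      fix i j
      assume i: "i \<in> I" and j: "j \<in> I"
      show "\<exists>x\<in>F i. \<exists>y\<in>F j. x \<le> y"
        unfolding F_def
        by (rule commuting_fixed_points_le[OF assms(1-3) assms(4)[OF i] assms(4)[OF j]
              assms(6)[OF i] assms(6)[OF j] _ _ assms(5)[OF i j]])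
          (simp_all add: assms(9)[OF i] assms(9)[OF j])
    qed
    then show ?thesis
      using False unfolding D F_def by blast
  qed
  moreover have "convex ?D"
    unfolding D using assms(2) convF by (intro convex_Int convex_INT)
  moreover have "closed ?D"
    unfolding D using closedC closedF by (intro closed_Int closed_INT ballI)
  moreover have "?D \<subseteq> C"
    unfolding D by blast
  ultimately show ?thesis
    using nonexpansive_retract_closed_convex by blast
qed

end
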